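(* For every integer $d\ge1$ there are constants $c_d,C_d>0$, depending only on $d$, such that for every integer $N\ge d$, $$c_d\,\frac{1}{N^{\frac12}}\ \le\ \rho(\mathcal{B}^N_{\le d})\ \le\ C_d\,\frac{1}{N^{\frac{d-1}{2d}}}.$$
   Context: Here $[N]=\{1,\dots,N\}$ and $\{\pm1\}^N$ carries the normalized counting measure, $\mathbb{E}[f]=2^{-N}\sum_{x\in\{\pm1\}^N}f(x)$. Every $f\colon\{\pm1\}^N\to\mathbb{R}$ has the Fourier-Walsh expansion $f(x)=\sum_{S\subset[N]}\widehat f(S)x^S$, where $x^S=\prod_{k\in S}x_k$ (with $x^\emptyset=1$) and $\widehat f(S)=\mathbb{E}[f(x)\,x^S]$. Put $\|f\|_\infty=\max_{x}|f(x)|$. For a class $\mathcal{F}$ of functions on $\{\pm1\}^N$, its Boolean radius is $$\rho(\mathcal{F})=\sup\Big\{\rho\ge 0:\ \sum_{S\subset[N]}|\widehat f(S)|\rho^{|S|}\le\|f\|_\infty\ \text{for every } f\in\mathcal{F}\Big\}.$$ The degree of a nonzero $f$ is $\deg f=\max\{|S|:\widehat f(S)\ne0\}$, and the zero function has degree $0$; $\mathcal{B}^N_{\le d}$ denotes the class of all $f\colon\{\pm1\}^N\to\mathbb{R}$ with $\deg f\le d$. *)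

theory Defs
  imports "HOL-Analysis.Analysis"
begin

definition cube :: "nat \<Rightarrow> (nat \<Rightarrow> real) set" where
  "cube N = {1..N} \<rightarrow>\<^sub>E {-1, 1}"

(* Functions on the cube are total functions on "nat \<Rightarrow> real"; every notion below
   looks only at their values on cube N. *)

definition expect :: "nat \<Rightarrow> ((nat \<Rightarrow> real) \<Rightarrow> real) \<Rightarrow> real" where
  "expect N f = (1 / 2 ^ N) * (\<Sum>x\<in>cube N. f x)"

definition walsh :: "nat set \<Rightarrow> (nat \<Rightarrow> real) \<Rightarrow> real" where
  "walsh S x = (\<Prod>k\<in>S. x k)"

definition fourier_coeff :: "nat \<Rightarrow> ((nat \<Rightarrow> real) \<Rightarrow> real) \<Rightarrow> nat set \<Rightarrow> real" where
  "fourier_coeff N f S = expect N (\<lambda>x. f x * walsh S x)"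

definition sup_norm :: "nat \<Rightarrow> ((nat \<Rightarrow> real) \<Rightarrow> real) \<Rightarrow> real" where
  "sup_norm N f = Max ((\<lambda>x. \<bar>f x\<bar>) ` cube N)"

definition cube_degree :: "nat \<Rightarrow> ((nat \<Rightarrow> real) \<Rightarrow> real) \<Rightarrow> nat" where
  "cube_degree N f =
     (if \<forall>x\<in>cube N. f x = 0 then 0
      else Max {card S | S. S \<subseteq> {1..N} \<and> fourier_coeff N f S \<noteq> 0})"

(* The supremum is taken in the extended reals, because the set of admissible radii
   is unbounded for some classes (for instance, the class of constants). *)
definition boolean_radius :: "nat \<Rightarrow> ((nat \<Rightarrow> real) \<Rightarrow> real) set \<Rightarrow> ereal" where
  "boolean_radius N F =
     Sup {ereal r | r. 0 \<le> r \<and>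
       (\<forall>f\<in>F. (\<Sum>S\<in>Pow {1..N}. \<bar>fourier_coeff N f S\<bar> * r ^ card S) \<le> sup_norm N f)}"

(* The extensional function space contains exactly one representative of each
   function from the cube to the reals. *)
definition bool_fun_le :: "nat \<Rightarrow> nat \<Rightarrow> ((nat \<Rightarrow> real) \<Rightarrow> real) set" where
  "bool_fun_le N d = {f \<in> cube N \<rightarrow>\<^sub>E UNIV. cube_degree N f \<le> d}"

end

theory Submission
  imports Defs
begin

text \<open>
  Lower bound. Let \<open>f\<close> have degree at most \<open>d\<close>, sup norm \<open>M\<close> and mean \<open>a\<close>, say with \<open>a \<ge> 0\<close>. The
  constant coefficient already contributes \<open>a\<close>, so the remaining coefficients have to fit into the
  gap \<open>M - a\<close>, which may be small. Since \<open>M - f\<close> is nonnegative with mean \<open>M - a\<close>, the function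
  \<open>f - a\<close> has \<open>L\<^sup>1\<close> norm at most \<open>2 (M - a)\<close>. The Bonami inequality \<open>bonami\<close> makes the
  \<open>L\<^sup>1\<close> and \<open>L\<^sup>2\<close> norms comparable in degree at most \<open>d\<close>, so the \<open>L\<^sup>2\<close> norm of \<open>f - a\<close> is
  \<open>O\<^sub>d(M - a)\<close> as well. Parseval and the Cauchy-Schwarz inequality then bound
  \<open>\<Sum>\<^bsub>S \<noteq> {}\<^esub> \<bar>fourier_coeff N f S\<bar> r\<^bsup>card S\<^esup>\<close> by this norm times
  \<open>sqrt ((1 + r\<^sup>2)\<^sup>N - 1)\<close>, and the last factor is of order \<open>r * sqrt N\<close>. A small multiple of
  \<open>1 / sqrt N\<close> is therefore an admissible radius (\<open>bohr_inequality_bounded_degree\<close>).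

  Upper bound. A \<open>d\<close>-homogeneous polynomial whose \<open>m = N choose d\<close> coefficients are random signs is
  subgaussian of variance \<open>m\<close> at each of the \<open>2\<^sup>N\<close> points of the cube, so by a union bound some
  choice of signs has sup norm \<open>O(sqrt (N m))\<close> (\<open>ex_homogeneous_small_sup_norm\<close>). Its weighted
  coefficient sum is \<open>m r\<^sup>d\<close>, so an admissible \<open>r\<close> satisfies \<open>r\<^sup>d = O(sqrt (N / m))\<close>, where \<open>m\<close> is of
  order \<open>N\<^sup>d\<close> (\<open>bohr_radius_power_le\<close>).
\<close>

section \<open>Averages over the cube\<close>

lemma finite_cube [simp]: "finite (cube N)"
  by (simp add: cube_def finite_PiE)

lemma cube_nonempty [simp]: "cube N \<noteq> {}"
  by (auto simp: cube_def PiE_eq_empty_iff)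

lemma card_cube [simp]: "card (cube N) = 2 ^ N"
  by (simp add: cube_def card_funcsetE numeral_2_eq_2)

lemma cube_coord: "x \<in> cube N \<Longrightarrow> k \<in> {1..N} \<Longrightarrow> x k = -1 \<or> x k = 1"
  unfolding cube_def by (drule PiE_mem) auto

lemma expect_cong: "(\<And>x. x \<in> cube N \<Longrightarrow> f x = g x) \<Longrightarrow> expect N f = expect N g"
  by (simp add: expect_def)

lemma expect_add: "expect N (\<lambda>x. f x + g x) = expect N f + expect N g"
  by (simp add: expect_def sum.distrib algebra_simps)

lemma expect_diff: "expect N (\<lambda>x. f x - g x) = expect N f - expect N g"
  by (simp add: expect_def sum_subtractf algebra_simps)

lemma expect_cmult: "expect N (\<lambda>x. a * f x) = a * expect N f"
  unfolding expect_def sum_distrib_left by (simp add: mult_ac)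

lemma expect_const [simp]: "expect N (\<lambda>x. a) = a"
  by (simp add: expect_def)

lemma expect_sum: "expect N (\<lambda>x. \<Sum>i\<in>I. f i x) = (\<Sum>i\<in>I. expect N (f i))"
  by (simp add: expect_def sum_distrib_left sum.swap[of _ I])

lemma expect_mono: "(\<And>x. x \<in> cube N \<Longrightarrow> f x \<le> g x) \<Longrightarrow> expect N f \<le> expect N g"
  unfolding expect_def by (intro mult_left_mono sum_mono) auto

lemma expect_nonneg: "(\<And>x. x \<in> cube N \<Longrightarrow> 0 \<le> f x) \<Longrightarrow> 0 \<le> expect N f"
  unfolding expect_def by (intro mult_nonneg_nonneg sum_nonneg) auto

lemma abs_expect_le: "\<bar>expect N f\<bar> \<le> expect N (\<lambda>x. \<bar>f x\<bar>)"
  by (simp add: expect_def abs_mult divide_right_mono)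

lemma expect_Cauchy_Schwarz:
  "(expect N (\<lambda>x. f x * g x))\<^sup>2 \<le> expect N (\<lambda>x. (f x)\<^sup>2) * expect N (\<lambda>x. (g x)\<^sup>2)"
proof -
  have "(1 / 2 ^ N)\<^sup>2 * (\<Sum>x\<in>cube N. f x * g x)\<^sup>2
      \<le> (1 / 2 ^ N)\<^sup>2 * ((\<Sum>x\<in>cube N. (f x)\<^sup>2) * (\<Sum>x\<in>cube N. (g x)\<^sup>2))"
    by (intro mult_left_mono Cauchy_Schwarz_ineq_sum) auto
  then show ?thesis
    by (simp add: expect_def power_mult_distrib power2_eq_square mult_ac)
qed

text \<open>
  Averaging over the last coordinate first; this is the recursion behind the induction on the
  dimension in Bonami's inequality.
\<close>

lemma expect_Suc:
  "expect (Suc N) f = expect N (\<lambda>x. (f (x(Suc N := 1)) + f (x(Suc N := -1))) / 2)"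
proof -
  have eq: "cube (Suc N) = (\<lambda>(y, g). g(Suc N := y)) ` ({-1, 1} \<times> cube N)"
    by (simp add: cube_def atLeastAtMostSuc_conv PiE_insert_eq)
  have inj: "inj_on (\<lambda>(y, g). g(Suc N := y)) ({-1, 1::real} \<times> cube N)"
    unfolding cube_def by (rule inj_combinator) auto
  have "sum f (cube (Suc N)) = (\<Sum>(y, x)\<in>{-1, 1}\<times>cube N. f (x(Suc N := y)))"
    unfolding eq by (subst sum.reindex[OF inj]) (simp add: case_prod_unfold)
  also have "\<dots> = (\<Sum>x\<in>cube N. f (x(Suc N := 1)) + f (x(Suc N := -1)))"
    by (simp add: sum.cartesian_product[symmetric] sum.distrib add.commute)
  finally show ?thesis
    by (simp add: expect_def sum_divide_distrib[symmetric])
qed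

lemma abs_le_sup_norm: "x \<in> cube N \<Longrightarrow> \<bar>f x\<bar> \<le> sup_norm N f"
  unfolding sup_norm_def by (intro Max_ge) auto

lemma sup_norm_le: "(\<And>x. x \<in> cube N \<Longrightarrow> \<bar>f x\<bar> \<le> K) \<Longrightarrow> sup_norm N f \<le> K"
  unfolding sup_norm_def by (subst Max_le_iff) auto


section \<open>Fourier-Walsh analysis\<close>

lemma abs_walsh:
  assumes "x \<in> cube N" "S \<subseteq> {1..N}"
  shows "\<bar>walsh S x\<bar> = 1"
proof -
  have "\<bar>x k\<bar> = 1" if "k \<in> S" for k
  proof -
    have "x k = -1 \<or> x k = 1"
      using assms that by (intro cube_coord[of x N]) auto
    then show ?thesis by auto
  qed
  then show ?thesis by (simp add: walsh_def abs_prod)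
qed

text \<open>
  The sum is the expansion of the product \<open>\<Prod>k. (1 + x k * y k)\<close>, in which a single coordinate where
  \<open>x\<close> and \<open>y\<close> differ produces a zero factor. Fourier inversion is this identity averaged
  against \<open>f\<close>, and Parseval's identity follows from inversion.
\<close>

lemma walsh_kernel:
  assumes "x \<in> cube N" "y \<in> cube N"
  shows "(\<Sum>S\<in>Pow {1..N}. walsh S x * walsh S y) = (if x = y then 2 ^ N else 0)"
proof -
  have "(\<Sum>S\<in>Pow {1..N}. walsh S x * walsh S y) = (\<Prod>k\<in>{1..N}. x k * y k + 1)"
    by (subst prod_add) (simp_all add: walsh_def prod.distrib)
  also have "\<dots> = (if x = y then 2 ^ N else 0)"
  proof (cases "x = y")
    case True
    have "x k * x k + 1 = 2" if "k \<in> {1..N}" for k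
      using cube_coord[OF assms(1) that] by auto
    with True show ?thesis by simp
  next
    case False
    then obtain k where k: "k \<in> {1..N}" "x k \<noteq> y k"
      using assms PiE_ext[of x "{1..N}" "\<lambda>_. {-1, 1}" y]
      unfolding cube_def by blast
    then have "x k * y k + 1 = 0"
      using cube_coord[OF assms(1) k(1)] cube_coord[OF assms(2) k(1)] by auto
    then have "(\<Prod>k\<in>{1..N}. x k * y k + 1) = 0"
      using k(1) by (intro prod_zero) auto
    with False show ?thesis by simp
  qed
  finally show ?thesis .
qed

definition walsh_poly :: "nat \<Rightarrow> (nat set \<Rightarrow> real) \<Rightarrow> (nat \<Rightarrow> real) \<Rightarrow> real" where
  "walsh_poly N c x = (\<Sum>S\<in>Pow {1..N}. c S * walsh S x)"

lemma fourier_inversion: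
  assumes "x \<in> cube N"
  shows "f x = walsh_poly N (fourier_coeff N f) x"
proof -
  have "walsh_poly N (fourier_coeff N f) x
      = expect N (\<lambda>y. \<Sum>S\<in>Pow {1..N}. f y * (walsh S x * walsh S y))"
    unfolding walsh_poly_def fourier_coeff_def expect_sum
    by (intro sum.cong refl) (simp add: mult_ac flip: expect_cmult)
  also have "\<dots> = expect N (\<lambda>y. if x = y then 2 ^ N * f y else 0)"
    by (intro expect_cong) (simp add: sum_distrib_left[symmetric] walsh_kernel[OF assms] del: One_nat_def)
  also have "\<dots> = f x"
    using assms by (simp add: expect_def)
  finally show ?thesis ..
qed

lemma parseval: "(\<Sum>S\<in>Pow {1..N}. (fourier_coeff N f S)\<^sup>2) = expect N (\<lambda>x. (f x)\<^sup>2)"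
proof -
  have "expect N (\<lambda>x. (f x)\<^sup>2) = expect N (\<lambda>x. f x * walsh_poly N (fourier_coeff N f) x)"
    by (intro expect_cong) (simp add: power2_eq_square flip: fourier_inversion)
  also have "\<dots> = (\<Sum>S\<in>Pow {1..N}. expect N (\<lambda>x. fourier_coeff N f S * (f x * walsh S x)))"
    unfolding walsh_poly_def sum_distrib_left expect_sum by (simp add: mult_ac)
  also have "\<dots> = (\<Sum>S\<in>Pow {1..N}. (fourier_coeff N f S)\<^sup>2)"
    by (simp add: expect_cmult power2_eq_square flip: fourier_coeff_def)
  finally show ?thesis ..
qed

text \<open>
  The average over the cube factorises over the coordinates, and a coordinate lying in exactly one
  of \<open>S\<close> and \<open>T\<close> averages to zero.
\<close>

lemma walsh_orthonormal:
  assumes "S \<subseteq> {1..N}" "T \<subseteq> {1..N}"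
  shows "expect N (\<lambda>x. walsh S x * walsh T x) = (if S = T then 1 else 0)"
proof -
  \<comment> \<open>Extend the products over \<open>S\<close> and \<open>T\<close> by ones to the full index set, so that both run over the
    same coordinates.\<close>
  define e where "e U k t = (if k \<in> U then t else 1)" for U and k :: nat and t :: real
  have "walsh U x = (\<Prod>k\<in>{1..N}. e U k (x k))" if "U \<subseteq> {1..N}" for U x
    unfolding walsh_def e_def using that
    by (simp add: prod.If_cases Int_absorb1 Int_absorb2 Int_commute del: One_nat_def)
  then have "(\<Sum>x\<in>cube N. walsh S x * walsh T x)
      = (\<Sum>x\<in>cube N. \<Prod>k\<in>{1..N}. e S k (x k) * e T k (x k))"
    using assms by (simp add: prod.distrib)
  also have "\<dots> = (\<Prod>k\<in>{1..N}. \<Sum>t\<in>{-1, 1}. e S k t * e T k t)"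
    unfolding cube_def by (subst prod_sum_PiE) auto
  also have "\<dots> = (if S = T then 2 ^ N else 0)"
  proof (cases "S = T")
    case True
    moreover have "e T k (-1) * e T k (-1) + e T k 1 * e T k 1 = 2" for k
      by (simp add: e_def)
    ultimately show ?thesis by simp
  next
    case False
    then obtain k where "k \<in> {1..N}" "k \<in> S \<longleftrightarrow> k \<notin> T" using assms by blast
    then have "(\<Prod>k\<in>{1..N}. \<Sum>t\<in>{-1, 1}. e S k t * e T k t) = 0"
      by (intro prod_zero) (auto simp: e_def intro!: bexI[of _ k])
    with False show ?thesis by simp
  qed
  finally show ?thesis by (simp add: expect_def)
qed

lemma fourier_coeff_walsh_poly:
  assumes "S \<subseteq> {1..N}"
  shows "fourier_coeff N (walsh_poly N c) S = c S"
proof -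
  have "fourier_coeff N (walsh_poly N c) S
      = (\<Sum>T\<in>Pow {1..N}. c T * expect N (\<lambda>x. walsh T x * walsh S x))"
    unfolding fourier_coeff_def walsh_poly_def sum_distrib_right expect_sum
    by (simp add: mult.assoc expect_cmult)
  also have "\<dots> = (\<Sum>T\<in>Pow {1..N}. if T = S then c T else 0)"
    using assms by (intro sum.cong refl) (simp add: walsh_orthonormal)
  also have "\<dots> = c S"
    using assms by simp
  finally show ?thesis .
qed

lemma fourier_coeff_eq_0_of_degree:
  assumes "cube_degree N f \<le> d" "S \<subseteq> {1..N}" "card S > d"
  shows "fourier_coeff N f S = 0"
proof (cases "\<forall>x\<in>cube N. f x = 0")
  case True
  then show ?thesis by (simp add: fourier_coeff_def expect_def)
next
  case False
  show ?thesis
  proof (rule ccontr)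
    assume "fourier_coeff N f S \<noteq> 0"
    then have "card S \<le> Max {card S | S. S \<subseteq> {1..N} \<and> fourier_coeff N f S \<noteq> 0}"
      using assms(2) by (intro Max_ge) (auto intro: finite_subset[of _ "card ` Pow {1..N}"])
    with False assms show False
      by (simp add: cube_degree_def del: One_nat_def split: if_splits)
  qed
qed

lemma cube_degree_le:
  assumes "\<And>S. S \<subseteq> {1..N} \<Longrightarrow> fourier_coeff N f S \<noteq> 0 \<Longrightarrow> card S \<le> d"
  shows "cube_degree N f \<le> d"
proof (cases "\<forall>x\<in>cube N. f x = 0")
  case True
  then show ?thesis by (simp add: cube_degree_def)
next
  case False
  \<comment> \<open>The maximum is over a nonempty set: if all coefficients vanished, so would \<open>f\<close>.\<close>
  then obtain x where "x \<in> cube N" "f x \<noteq> 0" by auto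
  then have "walsh_poly N (fourier_coeff N f) x \<noteq> 0"
    by (simp flip: fourier_inversion)
  then obtain S where "S \<subseteq> {1..N}" "fourier_coeff N f S \<noteq> 0"
    unfolding walsh_poly_def by (metis (no_types, lifting) Pow_iff mult_zero_left sum.neutral)
  then have "Max {card S | S. S \<subseteq> {1..N} \<and> fourier_coeff N f S \<noteq> 0} \<le> d"
    using assms by (subst Max_le_iff) (auto intro: finite_subset[of _ "card ` Pow {1..N}"])
  with False show ?thesis by (simp add: cube_degree_def)
qed


section \<open>Hypercontractivity\<close>

text \<open>
  Splitting off the last variable: \<open>p = g + x\<^bsub>N + 1\<^esub> h\<close>, where the degree of \<open>h\<close> is one less than
  that of \<open>p\<close>.
\<close>

lemma walsh_poly_Suc:
  "walsh_poly (Suc N) c (x(Suc N := b))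
    = walsh_poly N c x + b * walsh_poly N (\<lambda>S. c (insert (Suc N) S)) x"
proof -
  have w: "walsh S (x(Suc N := b)) = walsh S x" if "S \<subseteq> {1..N}" for S
    unfolding walsh_def using that by (intro prod.cong) auto
  have w': "walsh (insert (Suc N) S) (x(Suc N := b)) = b * walsh S x" if "S \<subseteq> {1..N}" for S
  proof -
    have "Suc N \<notin> S" "finite S" using that by (auto intro: finite_subset)
    with w[OF that] show ?thesis by (simp add: walsh_def)
  qed
  have "walsh_poly (Suc N) c (x(Suc N := b))
      = (\<Sum>S\<in>Pow {1..N}. c S * walsh S (x(Suc N := b)))
      + (\<Sum>S\<in>insert (Suc N) ` Pow {1..N}. c S * walsh S (x(Suc N := b)))"
  proof -
    have "Pow {1..Suc N} = Pow {1..N} \<union> insert (Suc N) ` Pow {1..N}"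
      by (simp add: atLeastAtMostSuc_conv Pow_insert)
    then show ?thesis
      unfolding walsh_poly_def by (simp only:) (intro sum.union_disjoint; auto)
  qed
  also have "(\<Sum>S\<in>insert (Suc N) ` Pow {1..N}. c S * walsh S (x(Suc N := b)))
      = (\<Sum>S\<in>Pow {1..N}. c (insert (Suc N) S) * walsh (insert (Suc N) S) (x(Suc N := b)))"
  proof (subst sum.reindex)
    show "inj_on (insert (Suc N)) (Pow {1..N})"
      by (rule inj_onI, subst (asm) insert_ident) auto
  qed simp
  finally show ?thesis
    by (simp add: w w' walsh_poly_def sum_distrib_left mult_ac del: fun_upd_apply One_nat_def)
qed

text \<open>
  Bonami's inequality: the \<open>L\<^sup>4\<close> norm of a polynomial of degree \<open>d\<close> is at most \<open>sqrt 3 ^ d\<close> times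
  its \<open>L\<^sup>2\<close> norm. For \<open>p = g + x h\<close> with an independent sign \<open>x\<close>, the odd powers of \<open>x\<close> average out:
  \<open>E p\<^sup>2 = E g\<^sup>2 + E h\<^sup>2\<close> and \<open>E p\<^sup>4 = E g\<^sup>4 + 6 E g\<^sup>2h\<^sup>2 + E h\<^sup>4\<close>. The mixed term is bounded by the
  Cauchy-Schwarz inequality. Because \<open>h\<close> has degree at most \<open>d - 1\<close>, the bound for \<open>E h\<^sup>4\<close> gains a
  factor \<open>1 / 9\<close>; its square root \<open>1 / 3\<close> turns the coefficient \<open>6\<close> into the \<open>2\<close> of
  \<open>(E g\<^sup>2 + E h\<^sup>2)\<^sup>2\<close>.
\<close>

lemma bonami:
  assumes "\<And>S. S \<subseteq> {1..N} \<Longrightarrow> card S > d \<Longrightarrow> c S = 0"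
  shows "expect N (\<lambda>x. (walsh_poly N c x) ^ 4) \<le> 9 ^ d * (expect N (\<lambda>x. (walsh_poly N c x)\<^sup>2))\<^sup>2"
  using assms
proof (induction N arbitrary: c d)
  case 0
  have "1 * c {} ^ 4 \<le> 9 ^ d * c {} ^ 4"
    by (intro mult_right_mono) auto
  then show ?case
    by (simp add: walsh_poly_def walsh_def flip: power_mult)
next
  case (Suc N)
  define g where "g = walsh_poly N c"
  define h where "h = walsh_poly N (\<lambda>S. c (insert (Suc N) S))"
  define A where "A = expect N (\<lambda>x. (g x)\<^sup>2)"
  define B where "B = expect N (\<lambda>x. (h x)\<^sup>2)"
  define M where "M = expect N (\<lambda>x. (g x)\<^sup>2 * (h x)\<^sup>2)"
  have nonneg: "A \<ge> 0" "B \<ge> 0" "M \<ge> 0"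
    unfolding A_def B_def M_def by (auto intro!: expect_nonneg)
  have card_ins: "card (insert (Suc N) S) = Suc (card S)" if "S \<subseteq> {1..N}" for S
    using that by (subst card_insert_disjoint) (auto intro: finite_subset)
  have g4: "expect N (\<lambda>x. (g x) ^ 4) \<le> 9 ^ d * A\<^sup>2"
    unfolding g_def A_def by (intro Suc.IH Suc.prems) auto
  \<comment> \<open>Stated with the factor \<open>9\<close> on the left, the gain also makes sense for \<open>d = 0\<close>, where \<open>h\<close> vanishes.\<close>
  have h4: "9 * expect N (\<lambda>x. (h x) ^ 4) \<le> 9 ^ d * B\<^sup>2"
  proof (cases d)
    case 0
    have "c (insert (Suc N) S) = 0" if "S \<subseteq> {1..N}" for S
      using that 0 by (intro Suc.prems) (auto simp: card_ins)
    then have "h = (\<lambda>x. 0)"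
      by (auto simp: h_def walsh_poly_def fun_eq_iff intro!: sum.neutral)
    then show ?thesis by simp
  next
    case (Suc e)
    have "expect N (\<lambda>x. (h x) ^ 4) \<le> 9 ^ e * B\<^sup>2"
      unfolding h_def B_def
      by (intro Suc.IH) (auto simp: card_ins \<open>d = Suc e\<close> intro!: Suc.prems)
    with Suc show ?thesis by simp
  qed
  have M: "3 * M \<le> 9 ^ d * (A * B)"
  proof (rule power2_le_imp_le)
    have "M\<^sup>2 \<le> expect N (\<lambda>x. (g x) ^ 4) * expect N (\<lambda>x. (h x) ^ 4)"
      unfolding M_def using expect_Cauchy_Schwarz[of N "\<lambda>x. (g x)\<^sup>2" "\<lambda>x. (h x)\<^sup>2"]
      by (simp flip: power_mult)
    then have "(3 * M)\<^sup>2 \<le> expect N (\<lambda>x. (g x) ^ 4) * (9 * expect N (\<lambda>x. (h x) ^ 4))"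
      by (simp add: power_mult_distrib)
    also have "\<dots> \<le> (9 ^ d * A\<^sup>2) * (9 ^ d * B\<^sup>2)"
      by (intro mult_mono g4 h4) (auto intro!: expect_nonneg)
    also have "\<dots> = (9 ^ d * (A * B))\<^sup>2"
      by (simp add: power2_eq_square mult_ac)
    finally show "(3 * M)\<^sup>2 \<le> (9 ^ d * (A * B))\<^sup>2" .
  qed (use nonneg in auto)
  have "expect (Suc N) (\<lambda>x. (walsh_poly (Suc N) c x)\<^sup>2) = expect N (\<lambda>x. (g x)\<^sup>2 + (h x)\<^sup>2)"
    unfolding expect_Suc walsh_poly_Suc g_def[symmetric] h_def[symmetric]
    by (intro expect_cong) (simp add: power2_eq_square algebra_simps)
  then have E2: "expect (Suc N) (\<lambda>x. (walsh_poly (Suc N) c x)\<^sup>2) = A + B"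
    by (simp add: expect_add A_def B_def)
  have "expect (Suc N) (\<lambda>x. (walsh_poly (Suc N) c x) ^ 4)
      = expect N (\<lambda>x. (g x) ^ 4 + 6 * ((g x)\<^sup>2 * (h x)\<^sup>2) + (h x) ^ 4)"
    unfolding expect_Suc walsh_poly_Suc g_def[symmetric] h_def[symmetric]
    by (intro expect_cong) (simp add: power2_eq_square power4_eq_xxxx algebra_simps)
  also have "\<dots> = expect N (\<lambda>x. (g x) ^ 4) + 6 * M + expect N (\<lambda>x. (h x) ^ 4)"
    by (simp add: expect_add expect_cmult M_def)
  also have "\<dots> \<le> 9 ^ d * A\<^sup>2 + 2 * (9 ^ d * (A * B)) + 9 ^ d * B\<^sup>2"
  proof -
    have "expect N (\<lambda>x. (h x) ^ 4) \<ge> 0" by (intro expect_nonneg) auto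
    with h4 have "expect N (\<lambda>x. (h x) ^ 4) \<le> 9 ^ d * B\<^sup>2" by linarith
    with g4 M show ?thesis by linarith
  qed
  also have "\<dots> = 9 ^ d * (A + B)\<^sup>2"
    by (simp add: power2_eq_square algebra_simps)
  finally show ?case unfolding E2 .
qed

text \<open>
  The passage from \<open>L\<^sup>4\<close> to \<open>L\<^sup>1\<close>: below a threshold \<open>t\<close> one has \<open>p\<^sup>2 \<le> t \<bar>p\<bar>\<close>, above it
  \<open>p\<^sup>2 \<le> p\<^sup>4 / t\<^sup>2\<close>, and by Bonami's inequality the second part has small mean when \<open>t\<close> is large.
\<close>

lemma expect_square_le_expect_abs:
  assumes "\<And>S. S \<subseteq> {1..N} \<Longrightarrow> card S > d \<Longrightarrow> c S = 0"
  defines "p \<equiv> walsh_poly N c"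
  shows "expect N (\<lambda>x. (p x)\<^sup>2) \<le> 8 * 9 ^ d * (expect N (\<lambda>x. \<bar>p x\<bar>))\<^sup>2"
proof -
  define B where "B = expect N (\<lambda>x. (p x)\<^sup>2)"
  define L where "L = expect N (\<lambda>x. \<bar>p x\<bar>)"
  \<comment> \<open>With this threshold the contribution of large values is at most half of \<open>B\<close>.\<close>
  define t where "t = sqrt (2 * 9 ^ d * B)"
  have "B \<ge> 0" unfolding B_def by (intro expect_nonneg) auto
  show ?thesis
  proof (cases "B = 0")
    case True
    then show ?thesis by (simp add: B_def)
  next
    case False
    with \<open>B \<ge> 0\<close> have "B > 0" by simp
    then have t: "t > 0" "t\<^sup>2 = 2 * 9 ^ d * B" by (auto simp: t_def)
    have pw: "(p x)\<^sup>2 \<le> t * \<bar>p x\<bar> + (1 / t\<^sup>2) * (p x) ^ 4" for x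
    proof (cases "\<bar>p x\<bar> \<le> t")
      case True
      have "(p x)\<^sup>2 = \<bar>p x\<bar> * \<bar>p x\<bar>" by (simp add: power2_eq_square)
      also have "\<dots> \<le> t * \<bar>p x\<bar>" using True by (intro mult_right_mono) auto
      finally show ?thesis by (simp add: add_increasing2)
    next
      case False
      then have "t\<^sup>2 \<le> (p x)\<^sup>2" using t(1) by (intro abs_le_square_iff[THEN iffD1]) auto
      then have "t\<^sup>2 * (p x)\<^sup>2 \<le> (p x)\<^sup>2 * (p x)\<^sup>2" by (intro mult_right_mono) auto
      then have "(p x)\<^sup>2 \<le> (1 / t\<^sup>2) * (p x) ^ 4"
        using t(1) by (simp add: field_simps power4_eq_xxxx power2_eq_square)
      then show ?thesis using t(1) by (simp add: add_increasing)
    qed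
    have "B \<le> t * L + (1 / t\<^sup>2) * expect N (\<lambda>x. (p x) ^ 4)"
      using expect_mono[OF pw, of N] by (simp only: B_def L_def expect_add expect_cmult)
    also have "\<dots> \<le> t * L + (1 / t\<^sup>2) * (9 ^ d * B\<^sup>2)"
      using bonami[OF assms(1)] by (intro add_left_mono mult_left_mono) (auto simp: B_def p_def)
    also have "(1 / t\<^sup>2) * (9 ^ d * B\<^sup>2) = B / 2"
      using \<open>B > 0\<close> unfolding t(2) by (simp add: power2_eq_square)
    finally have "B \<le> 2 * (t * L)" by simp
    then have "B\<^sup>2 \<le> (2 * (t * L))\<^sup>2" using \<open>B > 0\<close> by (intro power_mono) auto
    also have "\<dots> = B * (8 * 9 ^ d * L\<^sup>2)" by (simp add: power_mult_distrib t(2))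
    finally have "B \<le> 8 * 9 ^ d * L\<^sup>2" using \<open>B > 0\<close> by (simp add: power2_eq_square[of B])
    then show ?thesis by (simp add: B_def L_def)
  qed
qed


section \<open>The lower bound\<close>

lemma sum_power_card_Pow:
  fixes r :: real
  assumes "finite A"
  shows "(\<Sum>S\<in>Pow A. r ^ card S) = (1 + r) ^ card A"
  using prod_add[OF assms, of "\<lambda>_. r" "\<lambda>_. 1"] by (simp add: add.commute)

text \<open>
  The naive estimate \<open>E (f - a)\<^sup>2 = E f\<^sup>2 - a\<^sup>2 \<le> M\<^sup>2 - a\<^sup>2\<close> bounds the \<open>L\<^sup>2\<close> norm of \<open>f - a\<close> only by a
  multiple of \<open>sqrt (M (M - \<bar>a\<bar>))\<close>, which is too large when \<open>\<bar>a\<bar>\<close> is close to \<open>M\<close>. Passing through the \<open>L\<^sup>1\<close> norm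
  gives a bound that is linear in \<open>M - \<bar>a\<bar>\<close>; this is where the degree enters.
\<close>

lemma bohr_inequality_bounded_degree:
  assumes deg: "cube_degree N f \<le> d" and r: "0 \<le> r" "8 * 3 ^ d * r * sqrt (real N) \<le> 1"
  shows "(\<Sum>S\<in>Pow {1..N}. \<bar>fourier_coeff N f S\<bar> * r ^ card S) \<le> sup_norm N f"
proof -
  define M where "M = sup_norm N f"
  define a where "a = fourier_coeff N f {}"
  define s where "s = (if a \<ge> 0 then 1 else - 1 :: real)"
  \<comment> \<open>The coefficients of \<open>f - a\<close>.\<close>
  define c where "c S = (if S = {} then 0 else fourier_coeff N f S)" for S
  define p where "p = walsh_poly N c"
  define P where "P = Pow {1..N} - {{}}"
  have s: "s * a = \<bar>a\<bar>" "\<bar>s\<bar> = 1" by (auto simp: s_def)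
  have a: "a = expect N f" by (simp add: a_def fourier_coeff_def walsh_def)
  have fM: "\<bar>f x\<bar> \<le> M" if "x \<in> cube N" for x
    unfolding M_def using that by (rule abs_le_sup_norm)
  have "\<bar>a\<bar> \<le> expect N (\<lambda>x. \<bar>f x\<bar>)" unfolding a by (rule abs_expect_le)
  also have "\<dots> \<le> expect N (\<lambda>x. M)" by (intro expect_mono fM)
  finally have aM: "\<bar>a\<bar> \<le> M" by simp
  have split: "(\<Sum>S\<in>Pow {1..N}. F S) = F {} + (\<Sum>S\<in>P. F S)" for F :: "nat set \<Rightarrow> real"
    unfolding P_def by (rule sum.remove) auto
  have px: "p x = f x - a" if "x \<in> cube N" for x
  proof -
    have "f x = a + (\<Sum>S\<in>P. fourier_coeff N f S * walsh S x)"
      unfolding a_def fourier_inversion[OF that, of f] walsh_poly_def split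
      by (simp add: walsh_def)
    moreover have "p x = (\<Sum>S\<in>P. fourier_coeff N f S * walsh S x)"
      unfolding p_def walsh_poly_def split by (auto simp: c_def P_def intro!: sum.cong)
    ultimately show ?thesis by simp
  qed
  \<comment> \<open>Up to sign, \<open>f - a\<close> is the difference of two nonnegative functions of mean \<open>M - \<bar>a\<bar>\<close>.\<close>
  have "\<bar>p x\<bar> \<le> (M - \<bar>a\<bar>) + (M - s * f x)" if "x \<in> cube N" for x
  proof -
    have "\<bar>p x\<bar> = \<bar>(M - \<bar>a\<bar>) - (M - s * f x)\<bar>"
      unfolding px[OF that] s(1)[symmetric] s_def by auto
    moreover have "s * f x \<le> M" using fM[OF that] by (auto simp: s_def)
    ultimately show ?thesis using aM by linarith
  qed
  then have "expect N (\<lambda>x. \<bar>p x\<bar>) \<le> expect N (\<lambda>x. (M - \<bar>a\<bar>) + (M - s * f x))"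
    by (rule expect_mono)
  also have "\<dots> = 2 * (M - \<bar>a\<bar>)"
    unfolding expect_add expect_diff expect_cmult expect_const a[symmetric] s(1) by simp
  finally have L1: "expect N (\<lambda>x. \<bar>p x\<bar>) \<le> 2 * (M - \<bar>a\<bar>)" .
  have "(\<Sum>S\<in>P. (fourier_coeff N f S)\<^sup>2) = (\<Sum>S\<in>Pow {1..N}. (c S)\<^sup>2)"
    unfolding split by (auto simp: c_def P_def intro!: sum.cong)
  also have "\<dots> = expect N (\<lambda>x. (p x)\<^sup>2)"
    unfolding p_def parseval[symmetric] by (auto simp: fourier_coeff_walsh_poly intro!: sum.cong)
  also have "\<dots> \<le> 8 * 9 ^ d * (expect N (\<lambda>x. \<bar>p x\<bar>))\<^sup>2"
    unfolding p_def by (intro expect_square_le_expect_abs)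
      (auto simp: c_def fourier_coeff_eq_0_of_degree[OF deg])
  also have "\<dots> \<le> 8 * 9 ^ d * (2 * (M - \<bar>a\<bar>))\<^sup>2"
    by (intro mult_left_mono power_mono L1 expect_nonneg) auto
  also have "\<dots> = 32 * 9 ^ d * (M - \<bar>a\<bar>)\<^sup>2"
    unfolding power_mult_distrib by simp
  finally have L2: "(\<Sum>S\<in>P. (fourier_coeff N f S)\<^sup>2) \<le> 32 * 9 ^ d * (M - \<bar>a\<bar>)\<^sup>2" .
  have Nr: "64 * 9 ^ d * (r\<^sup>2 * real N) \<le> 1"
  proof -
    have "(8 * 3 ^ d * r * sqrt (real N))\<^sup>2 \<le> 1"
      using r by (intro power_le_one) auto
    moreover have "((3::real) ^ d)\<^sup>2 = 9 ^ d"
      by (simp add: power2_eq_square flip: power_mult_distrib)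
    ultimately show ?thesis by (simp add: power_mult_distrib mult_ac)
  qed
  have y: "0 \<le> r\<^sup>2 * real N" "r\<^sup>2 * real N \<le> 1"
  proof -
    have "1 * (r\<^sup>2 * real N) \<le> (64 * 9 ^ d) * (r\<^sup>2 * real N)"
    proof (intro mult_right_mono)
      show "1 \<le> 64 * (9::real) ^ d" using one_le_power[of "9::real" d] by linarith
    qed simp
    with Nr show "r\<^sup>2 * real N \<le> 1" by linarith
  qed auto
  have "1 + (\<Sum>S\<in>P. (r ^ card S)\<^sup>2) = (1 + r\<^sup>2) ^ N"
    using split[of "\<lambda>S. (r\<^sup>2) ^ card S"] sum_power_card_Pow[of "{1..N}" "r\<^sup>2"]
    by (simp add: mult.commute flip: power_mult)
  also have "\<dots> \<le> exp (r\<^sup>2) ^ N"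
    by (intro power_mono exp_ge_add_one_self) auto
  also have "\<dots> = exp (r\<^sup>2 * real N)"
    by (simp add: exp_of_nat2_mult)
  also have "\<dots> \<le> 1 + r\<^sup>2 * real N + (r\<^sup>2 * real N)\<^sup>2"
    using y by (rule exp_bound)
  also have "(r\<^sup>2 * real N)\<^sup>2 \<le> r\<^sup>2 * real N"
    unfolding power2_eq_square[of "r\<^sup>2 * real N"] using y by (intro mult_left_le) auto
  finally have R2: "(\<Sum>S\<in>P. (r ^ card S)\<^sup>2) \<le> 2 * (r\<^sup>2 * real N)" by linarith
  have "(\<Sum>S\<in>P. \<bar>fourier_coeff N f S\<bar> * r ^ card S)\<^sup>2
      \<le> (\<Sum>S\<in>P. (fourier_coeff N f S)\<^sup>2) * (\<Sum>S\<in>P. (r ^ card S)\<^sup>2)"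
    using Cauchy_Schwarz_ineq_sum[of "\<lambda>S. \<bar>fourier_coeff N f S\<bar>" "\<lambda>S. r ^ card S" P] by simp
  also have "\<dots> \<le> (32 * 9 ^ d * (M - \<bar>a\<bar>)\<^sup>2) * (2 * (r\<^sup>2 * real N))"
    by (intro mult_mono L2 R2 sum_nonneg) auto
  also have "\<dots> = (M - \<bar>a\<bar>)\<^sup>2 * (64 * 9 ^ d * (r\<^sup>2 * real N))" by simp
  also have "\<dots> \<le> (M - \<bar>a\<bar>)\<^sup>2" using Nr by (intro mult_left_le) auto
  finally have "(\<Sum>S\<in>P. \<bar>fourier_coeff N f S\<bar> * r ^ card S) \<le> M - \<bar>a\<bar>"
    by (rule power2_le_imp_le) (use aM in simp)
  then show ?thesis unfolding split by (simp add: a_def M_def)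
qed


section \<open>The upper bound\<close>

text \<open>
  A random sign is subgaussian: the inequality \<open>cosh y \<le> exp (y\<^sup>2 / 2)\<close> holds between the Taylor
  coefficients, because \<open>2\<^sup>n n! \<le> (2n)!\<close>.
\<close>

lemma exp_add_exp_minus_le: "exp y + exp (- y) \<le> 2 * exp (y\<^sup>2 / 2)" for y :: real
proof -
  have "cosh y \<le> exp (y\<^sup>2 / 2)"
  proof -
    have "(\<lambda>n. y ^ (2 * n) / fact (2 * n)) sums cosh y"
    proof -
      have "(\<lambda>n. if even n then y ^ n /\<^sub>R fact n else 0) sums cosh y"
        by (rule cosh_converges)
      moreover have "strict_mono (\<lambda>n::nat. 2 * n)" by (simp add: strict_mono_def)
      ultimately have "(\<lambda>n. if even (2 * n) then y ^ (2 * n) /\<^sub>R fact (2 * n) else 0) sums cosh y"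
        by (subst sums_mono_reindex) (auto elim!: evenE)
      then show ?thesis by (simp add: divide_inverse mult.commute)
    qed
    moreover have "(\<lambda>n. (y\<^sup>2 / 2) ^ n / fact n) sums exp (y\<^sup>2 / 2)"
    proof -
      have "(\<lambda>n. z ^ n / fact n) sums exp z" for z :: real
        using exp_converges[of z] by (simp add: divide_inverse mult.commute)
      then show ?thesis .
    qed
    moreover have "y ^ (2 * n) / fact (2 * n) \<le> (y\<^sup>2 / 2) ^ n / fact n" for n
    proof -
      have "2 ^ n * fact n \<le> (fact (2 * n) :: real)"
      proof (induction n)
        case (Suc n)
        have "2 ^ Suc n * fact (Suc n) = (2 * real n + 2) * 1 * (2 ^ n * fact n)"
          unfolding fact_Suc power_Suc of_nat_Suc by (simp only: algebra_simps)
        also have "\<dots> \<le> (2 * real n + 2) * (2 * real n + 1) * fact (2 * n)"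
          by (intro mult_mono Suc.IH order_refl) simp_all
        also have "\<dots> = fact (Suc (Suc (2 * n)))"
          unfolding fact_Suc by (simp add: add.commute)
        also have "Suc (Suc (2 * n)) = 2 * Suc n" by simp
        finally show ?case .
      qed simp
      then have "y ^ (2 * n) / fact (2 * n) \<le> y ^ (2 * n) / (2 ^ n * fact n)"
        by (intro divide_left_mono) auto
      then show ?thesis by (simp add: power_divide power_mult)
    qed
    ultimately show ?thesis by (meson sums_le)
  qed
  then show ?thesis by (simp add: cosh_field_def)
qed

text \<open>
  The probabilistic method with exponential moments. For a random choice of signs, each sum has
  moment generating function at most \<open>exp (l\<^sup>2 m / 2)\<close> at \<open>l\<close>, where \<open>m\<close> is the number of signs. Some
  choice does at least as well as the average simultaneously for all points of \<open>X\<close> and both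
  directions, that is, for \<open>2 card X \<le> exp L\<close> events.
\<close>

lemma ex_signs_small_sums:
  fixes v :: "'x \<Rightarrow> 'i \<Rightarrow> real"
  assumes I: "finite I" "I \<noteq> {}" and X: "finite X"
    and card: "real (2 * card X) \<le> exp L" and "L > 0"
    and v: "\<And>x i. x \<in> X \<Longrightarrow> i \<in> I \<Longrightarrow> \<bar>v x i\<bar> \<le> 1"
  shows "\<exists>\<epsilon>. \<epsilon> \<in> I \<rightarrow>\<^sub>E {-1, 1} \<and>
    (\<forall>x\<in>X. \<bar>\<Sum>i\<in>I. \<epsilon> i * v x i\<bar> \<le> sqrt (2 * L * real (card I)))"
proof -
  define m where "m = real (card I)"
  have "m > 0" using I by (simp add: m_def card_gt_0_iff)
  \<comment> \<open>This \<open>l\<close> minimises the resulting bound \<open>L / l + l m / 2\<close>.\<close>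
  define l where "l = sqrt (2 * L / m)"
  have l: "l > 0" "l\<^sup>2 = 2 * L / m" using \<open>L > 0\<close> \<open>m > 0\<close> by (auto simp: l_def)
  define E where "E = (I \<rightarrow>\<^sub>E {-1, 1 :: real})"
  have E: "finite E" "card E = 2 ^ card I" "E \<noteq> {}"
    using I by (simp_all add: E_def card_funcsetE finite_PiE PiE_eq_empty_iff numeral_2_eq_2)
  define Z where "Z \<epsilon> x = l * (\<Sum>i\<in>I. \<epsilon> i * v x i)" for \<epsilon> x
  have mgf: "(\<Sum>\<epsilon>\<in>E. exp (t * Z \<epsilon> x)) \<le> 2 ^ card I * exp L"
    if x: "x \<in> X" and t: "\<bar>t\<bar> = 1" for t x
  proof -
    have "(\<Sum>\<epsilon>\<in>E. exp (t * Z \<epsilon> x)) = (\<Sum>\<epsilon>\<in>E. \<Prod>i\<in>I. exp (t * l * v x i * \<epsilon> i))"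
      by (simp add: Z_def exp_sum[OF I(1), symmetric] sum_distrib_left mult_ac)
    also have "\<dots> = (\<Prod>i\<in>I. \<Sum>s\<in>{-1, 1}. exp (t * l * v x i * s))"
      unfolding E_def using I by (subst prod_sum_PiE) auto
    also have "\<dots> \<le> (\<Prod>i\<in>I. 2 * exp (L / m))"
    proof (intro prod_mono conjI)
      fix i assume i: "i \<in> I"
      have "(\<Sum>s\<in>{-1, 1}. exp (t * l * v x i * s)) \<le> 2 * exp ((t * l * v x i)\<^sup>2 / 2)"
        using exp_add_exp_minus_le[of "t * l * v x i"] by simp
      also have "(t * l * v x i)\<^sup>2 \<le> l\<^sup>2"
      proof -
        have "t\<^sup>2 = 1" using t by (metis power2_abs power_one)
        moreover have "(v x i)\<^sup>2 \<le> 1" using v[OF x i] by (simp add: abs_square_le_1)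
        ultimately show ?thesis by (simp add: power_mult_distrib mult_left_le)
      qed
      finally show "(\<Sum>s\<in>{-1, 1}. exp (t * l * v x i * s)) \<le> 2 * exp (L / m)"
        by (simp add: l(2))
    qed (auto intro: sum_nonneg)
    also have "\<dots> = 2 ^ card I * exp L"
      using \<open>m > 0\<close> by (simp add: power_mult_distrib m_def flip: exp_of_nat_mult)
    finally show ?thesis .
  qed
  have "(\<Sum>\<epsilon>\<in>E. \<Sum>x\<in>X. exp (Z \<epsilon> x) + exp (- Z \<epsilon> x))
      = (\<Sum>x\<in>X. (\<Sum>\<epsilon>\<in>E. exp (1 * Z \<epsilon> x)) + (\<Sum>\<epsilon>\<in>E. exp ((-1) * Z \<epsilon> x)))"
    by (subst sum.swap) (simp add: sum.distrib)
  also have "\<dots> \<le> (\<Sum>x\<in>X. 2 ^ card I * exp L + 2 ^ card I * exp L)"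
    by (intro sum_mono add_mono mgf) auto
  also have "\<dots> = 2 ^ card I * exp L * real (2 * card X)" by simp
  also have "\<dots> \<le> 2 ^ card I * exp L * exp L"
    by (intro mult_left_mono card) auto
  also have "\<dots> = (\<Sum>\<epsilon>\<in>E. exp (2 * L))"
    using E(2) by (simp add: mult_exp_exp)
  finally have total: "(\<Sum>\<epsilon>\<in>E. \<Sum>x\<in>X. exp (Z \<epsilon> x) + exp (- Z \<epsilon> x)) \<le> (\<Sum>\<epsilon>\<in>E. exp (2 * L))" .
  have "\<exists>\<epsilon>\<in>E. (\<Sum>x\<in>X. exp (Z \<epsilon> x) + exp (- Z \<epsilon> x)) \<le> exp (2 * L)"
  proof (rule ccontr)
    assume "\<not> ?thesis"
    then have "(\<Sum>\<epsilon>\<in>E. exp (2 * L)) < (\<Sum>\<epsilon>\<in>E. \<Sum>x\<in>X. exp (Z \<epsilon> x) + exp (- Z \<epsilon> x))"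
      using E by (intro sum_strict_mono) auto
    with total show False by simp
  qed
  then obtain \<epsilon> where eps: "\<epsilon> \<in> E"
    and small: "(\<Sum>x\<in>X. exp (Z \<epsilon> x) + exp (- Z \<epsilon> x)) \<le> exp (2 * L)" by auto
  have "\<bar>\<Sum>i\<in>I. \<epsilon> i * v x i\<bar> \<le> sqrt (2 * L * m)" if "x \<in> X" for x
  proof -
    have "exp (Z \<epsilon> x) + exp (- Z \<epsilon> x) \<le> (\<Sum>x\<in>X. exp (Z \<epsilon> x) + exp (- Z \<epsilon> x))"
      using that X by (intro member_le_sum) (auto intro: add_nonneg_nonneg)
    with small have "exp (Z \<epsilon> x) + exp (- Z \<epsilon> x) \<le> exp (2 * L)" by linarith
    moreover have "exp \<bar>Z \<epsilon> x\<bar> \<le> exp (Z \<epsilon> x) + exp (- Z \<epsilon> x)"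
      by (auto simp: abs_if)
    ultimately have "\<bar>Z \<epsilon> x\<bar> \<le> 2 * L" by (meson exp_le_cancel_iff order_trans)
    then have "l * \<bar>\<Sum>i\<in>I. \<epsilon> i * v x i\<bar> \<le> 2 * L"
      using l(1) by (simp add: Z_def abs_mult)
    also have "2 * L = l * sqrt (2 * L * m)"
    proof -
      have "l * sqrt (2 * L * m) = sqrt ((2 * L)\<^sup>2)"
        using \<open>m > 0\<close> by (simp add: l_def power2_eq_square flip: real_sqrt_mult)
      also have "\<dots> = 2 * L"
        unfolding real_sqrt_abs using \<open>L > 0\<close> by simp
      finally show ?thesis ..
    qed
    finally show ?thesis using l(1) by simp
  qed
  with eps show ?thesis unfolding E_def m_def by blast
qed

text \<open>
  A Kahane-Salem-Zygmund polynomial. The cube has only \<open>2\<^sup>N\<close> points, so \<open>L = 2 N\<close> suffices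
  for the union bound.
\<close>

lemma ex_homogeneous_small_sup_norm:
  assumes "1 \<le> d" "d \<le> N"
  shows "\<exists>f\<in>bool_fun_le N d. sup_norm N f \<le> 2 * sqrt (real N * real (N choose d)) \<and>
    (\<forall>S\<in>Pow {1..N}. \<bar>fourier_coeff N f S\<bar> = (if card S = d then 1 else 0))"
proof -
  define I where "I = {S. S \<subseteq> {1..N} \<and> card S = d}"
  have I: "finite I" "card I = N choose d"
    unfolding I_def using n_subsets[of "{1..N}" d] by auto
  have "I \<noteq> {}" using I assms by (auto simp: zero_less_binomial)
  have "real (2 * card (cube N)) \<le> exp (2 * real N)"
  proof -
    have "real (2 * card (cube N)) = 2 ^ Suc N" by simp
    also have "\<dots> \<le> 2 ^ (2 * N)" using assms by (intro power_increasing) auto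
    also have "\<dots> \<le> exp 1 ^ (2 * N)"
      using exp_ge_add_one_self[of 1] by (intro power_mono) auto
    also have "\<dots> = exp (2 * real N)" by (simp flip: exp_of_nat_mult)
    finally show ?thesis .
  qed
  from ex_signs_small_sums[OF I(1) \<open>I \<noteq> {}\<close> finite_cube this, of "\<lambda>x S. walsh S x"] assms
  obtain \<epsilon> where eps: "\<epsilon> \<in> I \<rightarrow>\<^sub>E {-1, 1}"
    and bound: "\<And>x. x \<in> cube N \<Longrightarrow>
      \<bar>\<Sum>S\<in>I. \<epsilon> S * walsh S x\<bar> \<le> sqrt (2 * (2 * real N) * real (card I))"
    by (auto simp: abs_walsh I_def)
  define c where "c S = (if card S = d then \<epsilon> S else 0)" for S
  define f where "f = restrict (walsh_poly N c) (cube N)"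
  have coeff: "fourier_coeff N f S = c S" if "S \<subseteq> {1..N}" for S
  proof -
    have "fourier_coeff N f S = fourier_coeff N (walsh_poly N c) S"
      unfolding fourier_coeff_def f_def by (intro expect_cong) simp
    with that show ?thesis by (simp add: fourier_coeff_walsh_poly)
  qed
  have "f x = (\<Sum>S\<in>I. \<epsilon> S * walsh S x)" if "x \<in> cube N" for x
    using that unfolding f_def restrict_def walsh_poly_def c_def I_def
    by (auto intro!: sum.mono_neutral_cong_right split: if_splits)
  then have "\<bar>f x\<bar> \<le> 2 * sqrt (real N * real (N choose d))" if "x \<in> cube N" for x
    using bound[OF that] that by (simp add: I(2) real_sqrt_mult)
  then have "sup_norm N f \<le> 2 * sqrt (real N * real (N choose d))"
    by (rule sup_norm_le)
  moreover have "cube_degree N f \<le> d"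
    by (rule cube_degree_le) (auto simp: coeff c_def split: if_splits)
  moreover have "\<bar>fourier_coeff N f S\<bar> = (if card S = d then 1 else 0)" if "S \<subseteq> {1..N}" for S
    using PiE_mem[OF eps, of S] that by (auto simp: coeff c_def I_def)
  ultimately show ?thesis
    by (intro bexI[of _ f]) (auto simp: bool_fun_le_def f_def)
qed

lemma bohr_radius_power_le:
  assumes d: "1 \<le> d" "d \<le> N" and r: "0 \<le> r"
    and bohr: "\<And>f. f \<in> bool_fun_le N d \<Longrightarrow>
      (\<Sum>S\<in>Pow {1..N}. \<bar>fourier_coeff N f S\<bar> * r ^ card S) \<le> sup_norm N f"
  shows "r ^ (2 * d) \<le> 4 * real d ^ d * real N / real N ^ d"
proof -
  define m where "m = real (N choose d)"
  have "m > 0" using d by (simp add: m_def zero_less_binomial)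
  have "N > 0" using d by simp
  obtain f where f: "f \<in> bool_fun_le N d" "sup_norm N f \<le> 2 * sqrt (real N * m)"
    and coeff: "\<And>S. S \<in> Pow {1..N} \<Longrightarrow> \<bar>fourier_coeff N f S\<bar> = (if card S = d then 1 else 0)"
    using ex_homogeneous_small_sup_norm[OF d] unfolding m_def by auto
  have "m * r ^ d = (\<Sum>S | S \<subseteq> {1..N} \<and> card S = d. r ^ d)"
    using n_subsets[of "{1..N}" d] by (simp add: m_def)
  also have "\<dots> = (\<Sum>S\<in>Pow {1..N}. \<bar>fourier_coeff N f S\<bar> * r ^ card S)"
    by (rule sum.mono_neutral_cong_left) (auto simp: coeff)
  also have "\<dots> \<le> 2 * sqrt (real N * m)"
    using bohr[OF f(1)] f(2) by linarith
  finally have "(m * r ^ d)\<^sup>2 \<le> (2 * sqrt (real N * m))\<^sup>2"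
    using r \<open>m > 0\<close> by (intro power_mono) auto
  then have "m * (m * r ^ (2 * d)) \<le> m * (4 * real N)"
    using \<open>m > 0\<close> unfolding power_even_eq power_mult_distrib by (simp add: power2_eq_square mult_ac)
  then have *: "m * r ^ (2 * d) \<le> 4 * real N"
    using \<open>m > 0\<close> by simp
  have "(real N / real d) ^ d * r ^ (2 * d) \<le> m * r ^ (2 * d)"
    unfolding m_def using binomial_ge_n_over_k_pow_k[OF d(2), where ?'a = real] r
    by (intro mult_right_mono) auto
  with * have "(real N / real d) ^ d * r ^ (2 * d) \<le> 4 * real N" by linarith
  then show ?thesis
    using d \<open>N > 0\<close> by (simp add: field_simps power_divide)
qed


section \<open>Order of the Boolean radius\<close>

theorem theorem4p1:
  shows "\<forall>d::nat. d \<ge> 1 \<longrightarrow>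
    (\<exists>c C :: real. c > 0 \<and> C > 0 \<and>
      (\<forall>N::nat. N \<ge> d \<longrightarrow>
         ereal (c * (1 / real N powr (1 / 2))) \<le> boolean_radius N (bool_fun_le N d) \<and>
         boolean_radius N (bool_fun_le N d)
           \<le> ereal (C * (1 / real N powr ((real d - 1) / (2 * real d))))))"
proof (intro allI impI)
  fix d :: nat assume d: "d \<ge> 1"
  define c :: real where "c = 1 / (8 * 3 ^ d)"
  define C :: real where "C = 2 * real d"
  have lower: "ereal (c * (1 / real N powr (1 / 2))) \<le> boolean_radius N (bool_fun_le N d)"
    if N: "N \<ge> d" for N
  proof -
    have "N > 0" using N d by simp
    define r where "r = c * (1 / real N powr (1 / 2))"
    have "r \<ge> 0" by (simp add: r_def c_def)
    moreover have "8 * 3 ^ d * r * sqrt (real N) \<le> 1"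
      using \<open>N > 0\<close> by (simp add: r_def c_def powr_half_sqrt)
    ultimately show ?thesis
      unfolding boolean_radius_def r_def[symmetric]
      by (intro Sup_upper CollectI exI[of _ r] conjI refl ballI bohr_inequality_bounded_degree)
        (auto simp: bool_fun_le_def)
  qed
  have upper: "boolean_radius N (bool_fun_le N d)
      \<le> ereal (C * (1 / real N powr ((real d - 1) / (2 * real d))))" if N: "N \<ge> d" for N
  proof -
    have "N > 0" using N d by simp
    define R where "R = C * (1 / real N powr ((real d - 1) / (2 * real d)))"
    have "R \<ge> 0" by (simp add: R_def C_def)
    have "(real N powr ((real d - 1) / (2 * real d))) ^ (2 * d) = real N powr (real d - 1)"
      using d \<open>N > 0\<close> by (simp add: powr_power)
    also have "\<dots> = real N ^ d / real N"
      using \<open>N > 0\<close> by (simp add: powr_diff powr_realpow)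
    finally have "R ^ (2 * d) = C ^ (2 * d) * real N / real N ^ d"
      by (simp add: R_def power_mult_distrib power_divide)
    moreover have "4 * real d ^ d \<le> C ^ (2 * d)"
    proof -
      have "(4::real) \<le> 2 ^ (2 * d)" using power_increasing[of 2 "2 * d" "2::real"] d by simp
      moreover have "real d ^ d \<le> real d ^ (2 * d)" using d by (intro power_increasing) auto
      ultimately show ?thesis
        unfolding C_def power_mult_distrib by (intro mult_mono) auto
    qed
    ultimately have R: "4 * real d ^ d * real N / real N ^ d \<le> R ^ (2 * d)"
      by (auto intro!: divide_right_mono mult_right_mono)
    have "r \<le> R" if "0 \<le> r" "\<forall>f\<in>bool_fun_le N d.
        (\<Sum>S\<in>Pow {1..N}. \<bar>fourier_coeff N f S\<bar> * r ^ card S) \<le> sup_norm N f" for r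
    proof -
      have "r ^ (2 * d) \<le> R ^ (2 * d)"
        using bohr_radius_power_le[OF d N that(1)] that(2) R by force
      then show ?thesis
        using d \<open>R \<ge> 0\<close> \<open>0 \<le> r\<close> by (simp add: power_mono_iff)
    qed
    then show ?thesis
      unfolding boolean_radius_def R_def[symmetric] by (intro Sup_least) auto
  qed
  show "\<exists>c C :: real. c > 0 \<and> C > 0 \<and>
      (\<forall>N::nat. N \<ge> d \<longrightarrow>
         ereal (c * (1 / real N powr (1 / 2))) \<le> boolean_radius N (bool_fun_le N d) \<and>
         boolean_radius N (bool_fun_le N d)
           \<le> ereal (C * (1 / real N powr ((real d - 1) / (2 * real d)))))"
    using lower upper d by (intro exI[of _ c] exI[of _ C]) (auto simp: c_def C_def)
qed

end
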